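(* Let $p$ be a prime, $n$ a natural number and $G=\mathbb{Z}^n\ltimes \mathrm{UT}_n(\mathbb{Z}[1/p])$. Let $\mu$ be a probability measure on $G$ that has finite first moment with respect to word length and such that the group generated by $\operatorname{supp}\mu$ is non-abelian. Let $D$ be the displacement matrix associated with $\mu$. Let $i<j\le n$ be natural numbers such that $D_{ij}$ is negative and $\operatorname{sgn}(D_{ij})=\operatorname{sgn}(D_{kj})$ for all natural numbers $k$ between $i$ and $j$ (that is, $i<k<j$). Let $(y^{(m)},\varphi^{(m)})$, $m\ge1$, be the path of the right random walk associated with $\mu$. Then the sequence $(\varphi^{(m)}_{ij})_{m\ge 1}$ is almost surely convergent in $\mathbb{R}$.
   Context: $\mathrm{UT}_n(R)$ is the group of upper unitriangular $n\times n$ matrices over $R$. The product in $G$ is $(x,f)(y,g)=(x+y,\,f\,XgX^{-1})$, where $X=\operatorname{diag}(p^{x_1},\dots,p^{x_n})$ for $x=(x_1,\dots,x_n)\in\mathbb{Z}^n$. $G$ is a finitely generated discrete group; word length $|\cdot|$ is taken with respect to a finite generating set, and finite first moment means $\int_G|g|\,d\mu(g)<\infty$. For $1\le i\le n$, $\mu_i$ is the pushforward of $\mu$ under $(x,f)\mapsto x_i$, and $m_1(\mu_i)=\int_{\mathbb{Z}} z\,d\mu_i(z)$. The displacement matrix $D$ has entries $D_{ij}=m_1(\mu_i)-m_1(\mu_j)$ for $i<j$. The right random walk: $(x^{(k)},f^{(k)})_{k\ge1}$ are independent with common law $\mu$, and $(y^{(m)},\varphi^{(m)})=(x^{(1)},f^{(1)})(x^{(2)},f^{(2)})\cdots(x^{(m)},f^{(m)})$.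 *)

theory Defs
  imports "HOL-Probability.Probability" "HOL-Algebra.Generated_Groups"
begin

text \<open>
  The index set \<open>{1..n}\<close> is an arbitrary finite linearly ordered type \<open>'n\<close>, so \<open>n = CARD('n)\<close>.
\<close>

type_synonym 'n sq_matrix = "real ^ 'n ^ 'n"
type_synonym 'n elt = "(int ^ 'n) \<times> 'n sq_matrix"

text \<open>The ring \<open>\<int>[1/p]\<close>, as a subring of the reals.\<close>

definition Z_inv :: "nat \<Rightarrow> real set" where
  "Z_inv p = {of_int a / of_nat p ^ k | a k. True}"

definition UT :: "real set \<Rightarrow> 'n::{finite,linorder} sq_matrix set" where
  "UT R = {f. (\<forall>i j. f $ i $ j \<in> R) \<and> (\<forall>i. f $ i $ i = 1) \<and> (\<forall>i j. j < i \<longrightarrow> f $ i $ j = 0)}"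

definition diag_powers :: "nat \<Rightarrow> int ^ 'n \<Rightarrow> 'n sq_matrix" where
  "diag_powers p x = (\<chi> i j. if i = j then real p powi (x $ i) else 0)"

definition ZUT :: "nat \<Rightarrow> 'n::{finite,linorder} elt monoid" where
  "ZUT p =
    \<lparr>carrier = UNIV \<times> UT (Z_inv p),
     mult = (\<lambda>(x, f) (y, g).
       (x + y, f ** (diag_powers p x ** g ** matrix_inv (diag_powers p x)))),
     one = (0, mat 1)\<rparr>"

text \<open>Words may use the elements of \<open>S\<close> and their inverses, so \<open>S\<close> need not be symmetric.\<close>

definition word_length :: "('a, 'b) monoid_scheme \<Rightarrow> 'a set \<Rightarrow> 'a \<Rightarrow> nat" where
  "word_length G S g =
    (LEAST m. \<exists>ws. length ws = m \<and> set ws \<subseteq> S \<union> m_inv G ` S \<and> foldr (mult G) ws (one G) = g)"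

definition finite_generating_set :: "('a, 'b) monoid_scheme \<Rightarrow> 'a set \<Rightarrow> bool" where
  "finite_generating_set G S \<longleftrightarrow> finite S \<and> S \<subseteq> carrier G \<and> generate G S = carrier G"

definition marginal :: "'n::finite elt pmf \<Rightarrow> 'n \<Rightarrow> int pmf" where
  "marginal \<mu> i = map_pmf (\<lambda>(x, f). x $ i) \<mu>"

definition first_moment :: "int pmf \<Rightarrow> real" where
  "first_moment \<nu> = measure_pmf.expectation \<nu> real_of_int"

text \<open>Displacements are considered for \<open>i < j\<close>; the other entries are never used.\<close>

definition displacement_matrix :: "'n::finite elt pmf \<Rightarrow> 'n sq_matrix" where
  "displacement_matrix \<mu> = (\<chi> i j. first_moment (marginal \<mu> i) - first_moment (marginal \<mu> j))"

text \<open>The increments are \<open>g 1, g 2, \<dots>\<close>; the value \<open>g 0\<close> is not used.\<close>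

primrec right_walk :: "('a, 'b) monoid_scheme \<Rightarrow> (nat \<Rightarrow> 'a) \<Rightarrow> nat \<Rightarrow> 'a" where
  "right_walk G g 0 = one G"
| "right_walk G g (Suc m) = mult G (right_walk G g m) (g (Suc m))"

end

(*
  Write c_k = log p * m_1(mu_k).  By the strong law of large numbers p^(y_l - y_k) grows at most
  like exp ((c_l - c_k + o(1)) m), and the entries of the m-th increment f are at most
  exp (C |g_m|) = exp (o(m)).  The entries of phi satisfy
    phi_ik^(m+1) = phi_ik^(m) + sum over i <= l < k of phi_il^(m) p^(y_l - y_k) f_lk,
  so induction on k gives |phi_ik^(m)| <= exp ((M - c_k + o(1)) m) for i <= k < j, where
  M = max {c_l | i <= l < j}; at each step the rate M - c_k is nonnegative.  The sign condition on D
  says M < c_j, so the increments of phi_ij are summable.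
*)

theory Submission
  imports Defs "HOL-Library.Landau_Symbols"
begin

section \<open>The strong law of large numbers\<close>

text \<open>
  The proof follows Garsia's maximal ergodic lemma: with \<open>R n\<close> the maximum of the first \<open>n\<close>
  partial sums and \<open>0\<close>, and \<open>Q\<close> the shift-invariant event that \<open>R\<close> is unbounded, the expectation
  of \<open>R (Suc n) - R n\<close> on \<open>Q\<close> is nonnegative and tends to the expectation of \<open>X\<close> on \<open>Q\<close>. By
  invariance \<open>Q\<close> is independent of the first coordinate, so that limit is the mean of \<open>X\<close> times
  the probability of \<open>Q\<close>.
\<close>

lemma (in sequence_space) AE_bdd_above_partial_sums:
  fixes X :: "'a \<Rightarrow> real"
  assumes X: "integrable M X" and neg: "(\<integral>x. X x \<partial>M) < 0"
  shows "AE \<omega> in S. bdd_above (range (\<lambda>n. \<Sum>k<n. X (\<omega> k)))"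
proof -
  interpret MS: pair_prob_space M S
    by unfold_locales
  have [measurable]: "X \<in> borel_measurable M"
    using X by auto
  \<comment> \<open>The recursion peels off the first coordinate and passes to the shifted sequence,
    matching the splitting of \<open>S\<close> into head and tail.\<close>
  define R :: "nat \<Rightarrow> (nat \<Rightarrow> 'a) \<Rightarrow> real" where
    "R = rec_nat (\<lambda>_. 0) (\<lambda>_ r \<omega>. max 0 (X (\<omega> 0) + r (\<lambda>k. \<omega> (Suc k))))"
  have R_0: "R 0 \<omega> = 0" for \<omega>
    by (simp add: R_def)
  have R_Suc: "R (Suc n) \<omega> = max 0 (X (\<omega> 0) + R n (\<lambda>k. \<omega> (Suc k)))" for n \<omega>
    by (simp add: R_def)
  have R_Cons: "R (Suc n) (case_nat s \<omega>) = max 0 (X s + R n \<omega>)" for n s \<omega>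
    by (simp add: R_Suc)
  have R_nonneg: "0 \<le> R n \<omega>" for n \<omega>
    by (cases n) (auto simp: R_0 R_Suc)
  have R_step: "R n \<omega> \<le> R (Suc n) \<omega>" for n \<omega>
  proof (induction n arbitrary: \<omega>)
    case (Suc n)
    show ?case
      using Suc[of "\<lambda>k. \<omega> (Suc k)"] unfolding R_Suc[of "Suc n"] R_Suc[of n] by auto
  qed (simp add: R_0 R_nonneg)
  have R_mono: "m \<le> n \<Longrightarrow> R m \<omega> \<le> R n \<omega>" for m n \<omega>
    using lift_Suc_mono_le[of "\<lambda>n. R n \<omega>"] R_step by blast
  have sum_le_R: "(\<Sum>k<n. X (\<omega> k)) \<le> R n \<omega>" for n \<omega>
  proof (induction n arbitrary: \<omega>)
    case (Suc n)
    show ?case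
      using Suc[of "\<lambda>k. \<omega> (Suc k)"] by (simp add: R_Suc sum.lessThan_Suc_shift del: sum.lessThan_Suc)
  qed (simp add: R_0)
  have R_meas [measurable]: "R n \<in> borel_measurable S" for n
  proof (induction n)
    case 0
    have "R 0 = (\<lambda>_. 0)" by (simp add: R_0 fun_eq_iff)
    then show ?case by simp
  next
    case (Suc n)
    have [measurable]: "(\<lambda>\<omega>. R n (\<lambda>k. \<omega> (Suc k))) \<in> borel_measurable S"
      by (rule measurable_compose[OF _ Suc])
         (auto intro!: measurable_PiM_single' simp: space_PiM PiE_iff)
    have "R (Suc n) = (\<lambda>\<omega>. max 0 (X (\<omega> 0) + R n (\<lambda>k. \<omega> (Suc k))))"
      by (simp add: R_Suc fun_eq_iff)
    then show ?case by simp
  qed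
  have cons_meas: "(\<lambda>(s, \<omega>). case_nat s \<omega>) \<in> M \<Otimes>\<^sub>M S \<rightarrow>\<^sub>M S"
    by simp
  \<comment> \<open>\<open>PiM_iter\<close> presents \<open>S\<close> as the image of
    \<open>M \<Otimes>\<^sub>M S\<close> under prepending a coordinate, so head and tail are
    independent.\<close>
  have cons_integrable: "integrable S f \<longleftrightarrow> integrable (M \<Otimes>\<^sub>M S) (\<lambda>(s, \<omega>). f (case_nat s \<omega>))"
    and cons_integral: "(\<integral>\<omega>. f \<omega> \<partial>S) = (\<integral>(s, \<omega>). f (case_nat s \<omega>) \<partial>(M \<Otimes>\<^sub>M S))"
    if "f \<in> borel_measurable S" for f :: "_ \<Rightarrow> real"
    using integrable_distr_eq[OF cons_meas that] integral_distr[OF cons_meas that]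
    unfolding PiM_iter by (simp_all add: case_prod_unfold)
  have fst_integrable: "integrable (M \<Otimes>\<^sub>M S) (\<lambda>(s, \<omega>). h s)"
    if "integrable M h" for h :: "_ \<Rightarrow> real"
    using integrable_distr[of fst "M \<Otimes>\<^sub>M S" M h] that
    unfolding P.distr_pair_fst by (auto simp: case_prod_unfold)
  have snd_eq: "distr (M \<Otimes>\<^sub>M S) S snd = S"
    by (subst pair_sigma_finite.distr_pair_swap[OF MS.pair_sigma_finite_axioms])
       (simp add: distr_distr comp_def case_prod_unfold M.distr_pair_fst)
  have snd_integrable: "integrable (M \<Otimes>\<^sub>M S) (\<lambda>(s, \<omega>). h \<omega>)"
    and snd_integral: "(\<integral>(s, \<omega>). h \<omega> \<partial>(M \<Otimes>\<^sub>M S)) = (\<integral>s. h s \<partial>S)"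
    if "integrable S h" for h :: "_ \<Rightarrow> real"
    using integrable_distr[of snd "M \<Otimes>\<^sub>M S" S h] integral_distr[of snd "M \<Otimes>\<^sub>M S" S h] that
    unfolding snd_eq by (auto simp: case_prod_unfold)
  have R_int: "integrable S (R n)" for n
  proof (induction n)
    case 0
    have "R 0 = (\<lambda>_. 0)" by (simp add: R_0 fun_eq_iff)
    then show ?case by simp
  next
    case (Suc n)
    have "integrable (M \<Otimes>\<^sub>M S) (\<lambda>x. max 0 ((\<lambda>(s, \<omega>). X s) x + (\<lambda>(s, \<omega>). R n \<omega>) x))"
      by (intro integrable_max Bochner_Integration.integrable_add fst_integrable snd_integrable X Suc) simp
    then show ?case
      by (subst cons_integrable) (auto simp: R_Cons case_prod_unfold)
  qed
  \<comment> \<open>Natural thresholds keep the quantifiers countable, hence \<open>Q\<close>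
    measurable; \<open>Q_large\<close> gives back real ones.\<close>
  define Q where "Q \<omega> \<longleftrightarrow> (\<forall>c::nat. \<exists>n. real c < R n \<omega>)" for \<omega>
  define I where "I \<omega> = (indicator {\<omega>. Q \<omega>} \<omega> :: real)" for \<omega>
  have Q_meas [measurable]: "Measurable.pred S Q"
    unfolding Q_def by measurable
  have I_meas [measurable]: "I \<in> borel_measurable S"
    unfolding I_def by measurable
  have I_01: "0 \<le> I \<omega>" "I \<omega> \<le> 1" for \<omega>
    by (auto simp: I_def indicator_def)
  have Q_large: "\<exists>n. c < R n \<omega>" if "Q \<omega>" for c \<omega>
    using that real_arch_simple[of c] unfolding Q_def by (meson order_le_less_trans)
  have Q_Cons: "Q (case_nat s \<omega>) \<longleftrightarrow> Q \<omega>" for s \<omega>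
  proof
    assume Q: "Q (case_nat s \<omega>)"
    show "Q \<omega>"
      unfolding Q_def
    proof
      fix c :: nat
      from Q_large[OF Q, of "max 0 (X s + c)"] obtain n where n: "max 0 (X s + c) < R n (case_nat s \<omega>)"
        by auto
      then obtain m where "n = Suc m"
        by (cases n) (auto simp: R_0)
      with n show "\<exists>n. real c < R n \<omega>"
        by (auto simp: R_Cons intro!: exI[of _ m])
    qed
  next
    assume Q: "Q \<omega>"
    show "Q (case_nat s \<omega>)"
      unfolding Q_def
    proof
      fix c :: nat
      from Q_large[OF Q, of "c - X s"] obtain n where "c - X s < R n \<omega>"
        by auto
      then show "\<exists>n. real c < R n (case_nat s \<omega>)"
        by (intro exI[of _ "Suc n"]) (auto simp: R_Cons)
    qed
  qed
  then have I_Cons: "I (case_nat s \<omega>) = I \<omega>" for s \<omega>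
    by (simp add: I_def indicator_def)
  have RI_int: "integrable S (\<lambda>\<omega>. R n \<omega> * I \<omega>)" for n
    by (rule Bochner_Integration.integrable_bound[OF R_int[of n]])
       (use I_01 R_nonneg in \<open>auto simp: abs_mult intro!: mult_left_le\<close>)
  \<comment> \<open>In head-tail coordinates \<open>R (Suc n)\<close> is
    \<open>max 0 (X s + R n \<omega>)\<close>. The tail also has law \<open>S\<close>, so
    \<open>R n\<close> may be evaluated there, and the difference is
    \<open>max (- R n \<omega>) (X s)\<close>.\<close>
  have step_nonneg: "0 \<le> (\<integral>(s, \<omega>). max (- R n \<omega>) (X s) * I \<omega> \<partial>(M \<Otimes>\<^sub>M S))" for n
  proof -
    have "0 \<le> (\<integral>\<omega>. R (Suc n) \<omega> * I \<omega> \<partial>S) - (\<integral>\<omega>. R n \<omega> * I \<omega> \<partial>S)"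
      using RI_int[of n] RI_int[of "Suc n"] R_step I_01
      by (auto intro!: integral_mono mult_right_mono)
    also have "\<dots> = (\<integral>(s, \<omega>). max 0 (X s + R n \<omega>) * I \<omega> \<partial>(M \<Otimes>\<^sub>M S)) - (\<integral>(s, \<omega>). R n \<omega> * I \<omega> \<partial>(M \<Otimes>\<^sub>M S))"
      by (subst cons_integral, simp, subst snd_integral[OF RI_int]) (simp add: R_Cons I_Cons)
    also have "\<dots> = (\<integral>x. (\<lambda>(s, \<omega>). max 0 (X s + R n \<omega>) * I \<omega>) x - (\<lambda>(s, \<omega>). R n \<omega> * I \<omega>) x \<partial>(M \<Otimes>\<^sub>M S))"
      using RI_int[of "Suc n"] snd_integrable[OF RI_int[of n]]
      by (subst Bochner_Integration.integral_diff) (simp_all add: cons_integrable R_Cons I_Cons)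
    also have "\<dots> = (\<integral>(s, \<omega>). max (- R n \<omega>) (X s) * I \<omega> \<partial>(M \<Otimes>\<^sub>M S))"
      by (intro Bochner_Integration.integral_cong) (auto simp: max_def algebra_simps)
    finally show ?thesis .
  qed
  \<comment> \<open>On \<open>Q\<close>, \<open>R n\<close> eventually exceeds \<open>- X s\<close>
    and the integrand becomes constant; off \<open>Q\<close> it vanishes. Domination by
    \<open>\<bar>X s\<bar>\<close> uses that \<open>R n\<close> is nonnegative.\<close>
  have lim: "(\<lambda>n. \<integral>(s, \<omega>). max (- R n \<omega>) (X s) * I \<omega> \<partial>(M \<Otimes>\<^sub>M S))
      \<longlonglongrightarrow> (\<integral>(s, \<omega>). X s * I \<omega> \<partial>(M \<Otimes>\<^sub>M S))"
  proof (rule integral_dominated_convergence[where w="\<lambda>(s, \<omega>). \<bar>X s\<bar>"])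
    show "integrable (M \<Otimes>\<^sub>M S) (\<lambda>(s, \<omega>). \<bar>X s\<bar>)"
      by (rule fst_integrable) (use X in auto)
    show "AE x in M \<Otimes>\<^sub>M S. norm (case x of (s, \<omega>) \<Rightarrow> max (- R n \<omega>) (X s) * I \<omega>) \<le> (case x of (s, \<omega>) \<Rightarrow> \<bar>X s\<bar>)" for n
    proof (rule AE_I2, clarsimp simp: abs_mult)
      fix s \<omega>
      have "\<bar>max (- R n \<omega>) (X s)\<bar> \<le> \<bar>X s\<bar>"
        using R_nonneg[of n \<omega>] by auto
      then show "\<bar>max (- R n \<omega>) (X s)\<bar> * \<bar>I \<omega>\<bar> \<le> \<bar>X s\<bar>"
        using I_01[of \<omega>] mult_mono[of _ "\<bar>X s\<bar>" "\<bar>I \<omega>\<bar>" 1] by simp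
    qed
    show "AE x in M \<Otimes>\<^sub>M S. (\<lambda>n. case x of (s, \<omega>) \<Rightarrow> max (- R n \<omega>) (X s) * I \<omega>)
        \<longlonglongrightarrow> (case x of (s, \<omega>) \<Rightarrow> X s * I \<omega>)"
    proof (rule AE_I2, clarsimp)
      fix s \<omega>
      show "(\<lambda>n. max (- R n \<omega>) (X s) * I \<omega>) \<longlonglongrightarrow> X s * I \<omega>"
      proof (cases "Q \<omega>")
        case True
        then obtain N where N: "- X s < R N \<omega>"
          using Q_large by blast
        have "max (- R n \<omega>) (X s) * I \<omega> = X s * I \<omega>" if "N \<le> n" for n
          using N R_mono[OF that, of \<omega>] by (auto simp: max_def)
        then show ?thesis
          by (intro tendsto_eventually eventually_sequentiallyI[of N]) auto
      qed (simp add: I_def)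
    qed
  qed measurable
  have I_int: "integrable S I"
    by (rule P.integrable_const_bound[where B=1]) (use I_01 in auto)
  have "0 \<le> (\<integral>(s, \<omega>). X s * I \<omega> \<partial>(M \<Otimes>\<^sub>M S))"
    by (rule LIMSEQ_le_const[OF lim]) (use step_nonneg in auto)
  also have "\<dots> = (\<integral>x. X x \<partial>M) * (\<integral>\<omega>. I \<omega> \<partial>S)"
  proof -
    have "integrable (M \<Otimes>\<^sub>M S) (\<lambda>(s, \<omega>). X s * I \<omega>)"
      by (rule Bochner_Integration.integrable_bound[OF fst_integrable[OF X]])
         (use I_01 in \<open>auto simp: abs_mult case_prod_unfold intro!: mult_left_le\<close>)
    then show ?thesis
      by (subst MS.integral_fst'[symmetric]) simp_all
  qed
  \<comment> \<open>A negative mean times the probability of \<open>Q\<close> is nonnegative only if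
    that probability is zero.\<close>
  finally have "(\<integral>\<omega>. I \<omega> \<partial>S) \<le> 0"
    using neg by (simp add: zero_le_mult_iff)
  then have "(\<integral>\<omega>. I \<omega> \<partial>S) = 0"
    using I_01 by (intro antisym integral_nonneg_AE) auto
  then have "AE \<omega> in S. I \<omega> = 0"
    using integral_nonneg_eq_0_iff_AE[OF I_int] I_01 by auto
  then show ?thesis
  proof eventually_elim
    case (elim \<omega>)
    then have "\<not> Q \<omega>"
      by (auto simp: I_def)
    then obtain c :: nat where "\<forall>n. R n \<omega> \<le> c"
      by (auto simp: Q_def not_less)
    then show ?case
      using sum_le_R order_trans by (intro bdd_aboveI[of _ "real c"]) blast
  qed
qed

text \<open>Subtracting the mean and a further \<epsilon> > 0 makes the expectation negative, so the
  corrected partial sums are bounded above; dividing by n bounds the averages from above. The lower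
  bound is the same for \<open>- X\<close>. Taking \<epsilon> = 1/(q+1) leaves countably many null
  sets.\<close>

lemma (in sequence_space) strong_law_of_large_numbers:
  fixes X :: "'a \<Rightarrow> real"
  assumes X: "integrable M X"
  shows "AE \<omega> in S. (\<lambda>n. (\<Sum>k<n. X (\<omega> k)) / n) \<longlonglongrightarrow> (\<integral>x. X x \<partial>M)"
proof -
  define \<epsilon> where "\<epsilon> q = inverse (real (Suc q))" for q
  have \<epsilon>_pos: "0 < \<epsilon> q" for q
    by (simp add: \<epsilon>_def)
  have upper: "AE \<omega> in S. \<forall>q. bdd_above (range (\<lambda>n. \<Sum>k<n. Y (\<omega> k) - (\<integral>x. Y x \<partial>M) - \<epsilon> q))"
    if Y: "integrable M Y" for Y :: "'a \<Rightarrow> real"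
    unfolding AE_all_countable
  proof
    fix q
    show "AE \<omega> in S. bdd_above (range (\<lambda>n. \<Sum>k<n. Y (\<omega> k) - (\<integral>x. Y x \<partial>M) - \<epsilon> q))"
      using AE_bdd_above_partial_sums[of "\<lambda>x. Y x - (\<integral>x. Y x \<partial>M) - \<epsilon> q"] Y \<epsilon>_pos[of q]
      by (simp add: M.prob_space)
  qed
  have bound: "\<forall>\<^sub>F n in sequentially. (\<Sum>k<n. y k) / n < c + e"
    if bdd: "\<forall>q. bdd_above (range (\<lambda>n. \<Sum>k<n. y k - c - \<epsilon> q))" and "0 < e" for y :: "nat \<Rightarrow> real" and c e
  proof -
    obtain q where q: "\<epsilon> q < e / 2"
      unfolding \<epsilon>_def using reals_Archimedean[of "e / 2"] \<open>0 < e\<close> by auto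
    from bdd obtain B where "(\<Sum>k<n. y k - c - \<epsilon> q) \<le> B" for n
      unfolding bdd_above_def by blast
    then have B: "(\<Sum>k<n. y k) \<le> B + n * (c + \<epsilon> q)" for n
      by (auto simp: sum_subtractf algebra_simps)
    have "\<forall>\<^sub>F n in sequentially. B / real n < e / 2"
      by (rule order_tendstoD(2)[OF lim_const_over_n]) (use \<open>0 < e\<close> in simp)
    then show ?thesis
      using eventually_gt_at_top[of 0]
    proof eventually_elim
      case (elim n)
      have "(\<Sum>k<n. y k) / n \<le> B / n + (c + \<epsilon> q)"
        using B[of n] elim by (simp add: field_simps)
      then show ?case
        using elim q by linarith
    qed
  qed
  have "AE \<omega> in S. \<forall>q. bdd_above (range (\<lambda>n. \<Sum>k<n. - X (\<omega> k) - (- (\<integral>x. X x \<partial>M)) - \<epsilon> q))"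
    using upper[of "\<lambda>x. - X x"] X by simp
  with upper[OF X] show ?thesis
  proof eventually_elim
    case (elim \<omega>)
    show ?case
    proof (rule order_tendstoI)
      fix a assume "a < (\<integral>x. X x \<partial>M)"
      then show "\<forall>\<^sub>F n in sequentially. a < (\<Sum>k<n. X (\<omega> k)) / n"
        using bound[OF elim(2), of "(\<integral>x. X x \<partial>M) - a"] by (simp add: sum_negf)
    next
      fix a assume "(\<integral>x. X x \<partial>M) < a"
      then show "\<forall>\<^sub>F n in sequentially. (\<Sum>k<n. X (\<omega> k)) / n < a"
        using bound[OF elim(1), of "a - (\<integral>x. X x \<partial>M)"] by simp
    qed
  qed
qed

text \<open>Carries almost sure statements from the coordinate space to an i.i.d. sequence: by
  independence the joint law is a product measure, and reindexing along \<open>Suc\<close> matches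
  increments numbered from 1 with coordinates numbered from 0.\<close>

lemma (in prob_space) AE_indep_vars_shift:
  assumes indep: "indep_vars (\<lambda>_. N) g {1..}"
    and distr: "\<And>k. 1 \<le> k \<Longrightarrow> distr M N (g k) = K"
    and AE: "AE \<omega> in (\<Pi>\<^sub>M k\<in>(UNIV :: nat set). K). Q \<omega>"
  shows "AE \<omega> in M. Q (\<lambda>k. g (Suc k) \<omega>)"
proof -
  have rv: "random_variable N (g k)" if "k \<in> {1..}" for k
    using indep that by (auto simp: indep_vars_def2)
  have K: "prob_space K"
    using prob_space_distr[OF rv[of 1]] distr[of 1] by simp
  have "distr M (\<Pi>\<^sub>M k\<in>{1..}. N) (\<lambda>\<omega>. \<lambda>k\<in>{1..}. g k \<omega>) = (\<Pi>\<^sub>M k\<in>{1..}. distr M N (g k))"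
    using indep_vars_iff_distr_eq_PiM'[of "{1..}" g "\<lambda>_. N"] indep rv by auto
  also have "\<dots> = (\<Pi>\<^sub>M k\<in>{1..}. K)"
    by (rule PiM_cong) (auto simp: distr)
  finally have 1: "distr M (\<Pi>\<^sub>M k\<in>{1..}. N) (\<lambda>\<omega>. \<lambda>k\<in>{1..}. g k \<omega>) = (\<Pi>\<^sub>M k\<in>{1..}. K)" .
  have 2: "distr (\<Pi>\<^sub>M k\<in>{1..}. K) (\<Pi>\<^sub>M k\<in>UNIV. K) (\<lambda>\<omega>. \<lambda>k\<in>UNIV. \<omega> (Suc k)) = (\<Pi>\<^sub>M k\<in>(UNIV :: nat set). K)"
    using distr_PiM_reindex[of "{1..}" "\<lambda>_. K" Suc UNIV] K by auto
  have m1: "(\<lambda>\<omega>. \<lambda>k\<in>{1..}. g k \<omega>) \<in> M \<rightarrow>\<^sub>M (\<Pi>\<^sub>M k\<in>{1..}. N)"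
    using rv by (intro measurable_restrict) auto
  have m2: "(\<lambda>\<omega>. \<lambda>k\<in>UNIV. \<omega> (Suc k)) \<in> (\<Pi>\<^sub>M k\<in>{1..}. K) \<rightarrow>\<^sub>M (\<Pi>\<^sub>M k\<in>(UNIV :: nat set). K)"
    by (intro measurable_restrict measurable_component_singleton) auto
  have "AE \<omega> in (\<Pi>\<^sub>M k\<in>{1..}. K). Q (\<lambda>k\<in>UNIV. \<omega> (Suc k))"
    by (rule AE_distrD[OF m2]) (subst 2, rule AE)
  then have "AE \<omega> in M. Q (\<lambda>k\<in>UNIV. (\<lambda>k\<in>{1..}. g k \<omega>) (Suc k))"
    unfolding 1[symmetric] by (rule AE_distrD[OF m1])
  then show ?thesis
    by (simp add: restrict_def)
qed

section \<open>Exponential growth rates\<close>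

text \<open>Quantifying over \<epsilon> expresses the one-sided bound exp ((\<theta> + o(1)) n), so
  subexponential factors have rate 0.\<close>

definition exp_growth :: "(nat \<Rightarrow> real) \<Rightarrow> real \<Rightarrow> bool" where
  "exp_growth u \<theta> \<longleftrightarrow> (\<forall>\<epsilon>>0. u \<in> O(\<lambda>n. exp ((\<theta> + \<epsilon>) * real n)))"

lemma exp_growth_zero: "exp_growth (\<lambda>_. 0) \<theta>"
  by (simp add: exp_growth_def)

lemma exp_growth_bound:
  assumes "exp_growth v \<theta>" "\<And>n. \<bar>u n\<bar> \<le> v n"
  shows "exp_growth u \<theta>"
  unfolding exp_growth_def
proof (intro allI impI)
  fix \<epsilon> :: real assume "0 < \<epsilon>"
  have "u \<in> O(v)"
    by (rule bigoI[of _ 1], rule always_eventually) (auto intro: order_trans[OF assms(2) abs_ge_self])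
  also have "v \<in> O(\<lambda>n. exp ((\<theta> + \<epsilon>) * real n))"
    using assms(1) \<open>0 < \<epsilon>\<close> by (simp add: exp_growth_def)
  finally show "u \<in> O(\<lambda>n. exp ((\<theta> + \<epsilon>) * real n))" .
qed

lemma exp_growth_mult:
  assumes u: "exp_growth u \<theta>" and v: "exp_growth v \<eta>"
  shows "exp_growth (\<lambda>n. u n * v n) (\<theta> + \<eta>)"
  unfolding exp_growth_def
proof (intro allI impI)
  fix \<epsilon> :: real assume "0 < \<epsilon>"
  then have "(\<lambda>n. u n * v n) \<in> O(\<lambda>n. exp ((\<theta> + \<epsilon> / 2) * real n) * exp ((\<eta> + \<epsilon> / 2) * real n))"
    using u v unfolding exp_growth_def by (intro landau_o.big.mult) auto
  also have "(\<lambda>n. exp ((\<theta> + \<epsilon> / 2) * real n) * exp ((\<eta> + \<epsilon> / 2) * real n))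
      = (\<lambda>n. exp ((\<theta> + \<eta> + \<epsilon>) * real n))"
    by (simp add: exp_add[symmetric] algebra_simps fun_eq_iff)
  finally show "(\<lambda>n. u n * v n) \<in> O(\<lambda>n. exp ((\<theta> + \<eta> + \<epsilon>) * real n))" .
qed

lemma exp_growth_sum:
  assumes "\<And>x. x \<in> A \<Longrightarrow> exp_growth (f x) \<theta>"
  shows "exp_growth (\<lambda>n. \<Sum>x\<in>A. f x n) \<theta>"
  using assms unfolding exp_growth_def by (auto intro!: big_sum_in_bigo)

lemma exp_growth_exp:
  assumes "(\<lambda>n. z n / real n) \<longlonglongrightarrow> \<theta>"
  shows "exp_growth (\<lambda>n. exp (z n)) \<theta>"
  unfolding exp_growth_def
proof (intro allI impI)
  fix \<epsilon> :: real assume "0 < \<epsilon>"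
  then have "\<forall>\<^sub>F n in sequentially. z n / real n < \<theta> + \<epsilon>"
    by (intro order_tendstoD(2)[OF assms]) simp
  then have "\<forall>\<^sub>F n in sequentially. norm (exp (z n)) \<le> 1 * norm (exp ((\<theta> + \<epsilon>) * real n))"
    using eventually_gt_at_top[of 0] by eventually_elim (simp add: field_simps)
  then show "(\<lambda>n. exp (z n)) \<in> O(\<lambda>n. exp ((\<theta> + \<epsilon>) * real n))"
    by (rule landau_o.bigI[rotated]) simp
qed

text \<open>A geometric sum with ratio above 1 is comparable to its last term. The starting value
  has rate 0 and is absorbed because \<theta> is nonnegative.\<close>

lemma exp_growth_telescope:
  assumes "exp_growth (\<lambda>n. u (Suc n) - u n) \<theta>" "0 \<le> \<theta>"
  shows "exp_growth u \<theta>"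
  unfolding exp_growth_def
proof (intro allI impI)
  fix \<epsilon> :: real assume "0 < \<epsilon>"
  define r where "r = exp (\<theta> + \<epsilon>)"
  have r: "1 < r"
    using \<open>0 < \<epsilon>\<close> \<open>0 \<le> \<theta>\<close> by (simp add: r_def)
  have r_power: "exp ((\<theta> + \<epsilon>) * real n) = r ^ n" for n
    by (simp add: r_def exp_of_nat2_mult)
  have "(\<lambda>n. u (Suc n) - u n) \<in> O(\<lambda>n. exp ((\<theta> + \<epsilon>) * real n))"
    using assms(1) \<open>0 < \<epsilon>\<close> by (simp add: exp_growth_def)
  then obtain C where C: "0 < C" "\<forall>\<^sub>F n in sequentially. norm (u (Suc n) - u n) \<le> C * norm (r ^ n)"
    unfolding r_power by (elim landau_o.bigE)
  then obtain N where N: "\<And>n. N \<le> n \<Longrightarrow> \<bar>u (Suc n) - u n\<bar> \<le> C * r ^ n"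
    using r unfolding eventually_sequentially by auto
  \<comment> \<open>\<open>C / (r - 1)\<close> yields \<open>C \<le> B * (r - 1)\<close>, which is
    what the step from \<open>B * r ^ n\<close> to \<open>B * r ^ Suc n\<close> requires;
    \<open>\<bar>u N\<bar>\<close> serves the base case.\<close>
  define B where "B = \<bar>u N\<bar> + C / (r - 1)"
  have B: "0 \<le> B" "C \<le> B * (r - 1)"
    using r C(1) by (simp_all add: B_def distrib_right)
  have "\<bar>u n\<bar> \<le> B * r ^ n" if "N \<le> n" for n
    using that
  proof (induction n rule: dec_induct)
    case base
    have "\<bar>u N\<bar> \<le> B * 1"
      using r C(1) by (auto simp: B_def)
    also have "\<dots> \<le> B * r ^ N"
      using B r by (intro mult_left_mono one_le_power) auto
    finally show ?case .
  next
    case (step n)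
    have "\<bar>u (Suc n)\<bar> \<le> (B + C) * r ^ n"
      using step.IH N[OF step.hyps(1)] by (simp add: algebra_simps)
    also have "\<dots> \<le> (B * r) * r ^ n"
      using B r by (intro mult_right_mono) (auto simp: algebra_simps)
    finally show ?case by (simp add: algebra_simps)
  qed
  then show "u \<in> O(\<lambda>n. exp ((\<theta> + \<epsilon>) * real n))"
    by (intro bigoI[of _ B] eventually_sequentiallyI[of N]) (simp add: r_power[symmetric])
qed

text \<open>The choice \<epsilon> = - \<theta> / 2 leaves the negative rate \<theta> / 2, so a
  convergent geometric series dominates the increments.\<close>

lemma exp_growth_neg_convergent:
  assumes "exp_growth (\<lambda>n. u (Suc n) - u n) \<theta>" "\<theta> < 0"
  shows "convergent u"
proof -
  have "exp ((\<theta> + - \<theta> / 2) * real n) = exp (\<theta> / 2) ^ n" for n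
    by (simp add: exp_of_nat2_mult[symmetric])
  then have "(\<lambda>n. u (Suc n) - u n) \<in> O(\<lambda>n. exp (\<theta> / 2) ^ n)"
    using assms(1)[unfolded exp_growth_def, rule_format, of "- \<theta> / 2"] \<open>\<theta> < 0\<close> by simp
  moreover have "summable (\<lambda>n. norm (exp (\<theta> / 2) ^ n))"
    using \<open>\<theta> < 0\<close> by (simp add: summable_geometric)
  ultimately have "summable (\<lambda>n. u (Suc n) - u n)"
    by (rule summable_comparison_test_bigo[rotated])
  then have "convergent (\<lambda>n. \<Sum>k<n. u (Suc k) - u k)"
    by (simp add: summable_iff_convergent)
  then have "convergent (\<lambda>n. u n - u 0)"
    by (simp add: sum_lessThan_telescope)
  from convergent_add[OF this convergent_const[of "u 0"]] show ?thesis
    by simp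
qed

lemma triangular_recursion_convergent:
  fixes a :: "nat \<Rightarrow> 'n::{finite,linorder} \<Rightarrow> real"
  assumes zero: "\<And>m k. k < i \<Longrightarrow> a m k = 0"
    and step: "\<And>m k. a (Suc m) k = a m k + (\<Sum>l | l < k. a m l * w m l k)"
    and w: "\<And>l k. l < k \<Longrightarrow> exp_growth (\<lambda>m. w m l k) (c l - c k)"
    and "i < j"
    and less: "\<And>k. i \<le> k \<Longrightarrow> k < j \<Longrightarrow> c k < c j"
  shows "convergent (\<lambda>m. a m j)"
proof -
  define M where "M = Max (c ` {i..<j})"
  have ne: "{i..<j} \<noteq> {}"
    using \<open>i < j\<close> by auto
  have M_ge: "c k \<le> M" if "i \<le> k" "k < j" for k
    using that unfolding M_def by (intro Max_ge) auto
  have "M < c j"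
    using ne less unfolding M_def by auto
  \<comment> \<open>The rates telescope: \<open>(M - c l) + (c l - c k) = M - c k\<close>, whichever
    column \<open>l\<close> contributes.\<close>
  have increment: "exp_growth (\<lambda>m. a (Suc m) k - a m k) (M - c k)"
    if "\<And>l. l < k \<Longrightarrow> exp_growth (\<lambda>m. a m l) (M - c l)" for k
  proof -
    have "exp_growth (\<lambda>m. a m l * w m l k) (M - c k)" if "l < k" for l
      using exp_growth_mult[OF \<open>l < k \<Longrightarrow> exp_growth (\<lambda>m. a m l) (M - c l)\<close> w[OF \<open>l < k\<close>]] that by simp
    then show ?thesis
      by (auto simp: step intro!: exp_growth_sum)
  qed
  have "exp_growth (\<lambda>m. a m k) (M - c k)" if "k < j" for k
    using that
  \<comment> \<open>The index type is a finite linear order, so the induction runs over the number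
    of smaller indices.\<close>
  proof (induction k rule: measure_induct_rule[where f="\<lambda>k. card {..<k}"])
    case (less k)
    have IH: "exp_growth (\<lambda>m. a m l) (M - c l)" if "l < k" for l
      using that less.prems by (intro less.IH psubset_card_mono) (auto simp: psubset_eq)
    show ?case
    \<comment> \<open>Left of column \<open>i\<close> the rate may be negative, but the entries are
      zero. From \<open>i\<close> on, \<open>c k \<le> M\<close> gives the nonnegative rate that
      \<open>exp_growth_telescope\<close> requires.\<close>
    proof (cases "k < i")
      case True
      then show ?thesis by (simp add: zero exp_growth_zero)
    next
      case False
      then have "c k \<le> M"
        using less.prems by (intro M_ge) auto
      then show ?thesis
        using IH by (simp add: exp_growth_telescope[OF increment])
    qed
  qed
  then have "exp_growth (\<lambda>m. a (Suc m) j - a m j) (M - c j)"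
    by (rule increment)
  then show ?thesis
    by (rule exp_growth_neg_convergent) (use \<open>M < c j\<close> in simp)
qed

section \<open>Word length and random walks on \<open>ZUT\<close>\<close>

lemma powi_eq_exp:
  fixes x :: real
  assumes "0 < x"
  shows "x powi z = exp (of_int z * ln x)"
  using assms powr_real_of_int'[of x z] by (simp add: powr_def)

lemma matrix_inv_eqI:
  fixes A B :: "real ^ 'n ^ 'n"
  assumes "A ** B = mat 1"
  shows "matrix_inv A = B"
proof -
  have "B ** A = mat 1"
    using assms matrix_left_right_inverse by blast
  then have "A ** matrix_inv A = mat 1"
    using assms unfolding matrix_inv_def by (metis (mono_tags, lifting) someI)
  then have "B ** (A ** matrix_inv A) = B"
    by simp
  then show ?thesis
    by (simp add: matrix_mul_assoc \<open>B ** A = mat 1\<close>)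
qed

lemma diag_powers_mult_left:
  "(diag_powers p x ** f) $ a $ b = real p powi (x $ a) * f $ a $ b"
  by (simp add: matrix_matrix_mult_def diag_powers_def if_distrib[of "\<lambda>z. z * _"] cong: if_cong)

lemma diag_powers_mult_right:
  "(f ** diag_powers p x) $ a $ b = f $ a $ b * real p powi (x $ b)"
  by (simp add: matrix_matrix_mult_def diag_powers_def if_distrib[of "\<lambda>z. _ * z"] cong: if_cong)

lemma matrix_inv_diag_powers:
  assumes "0 < p"
  shows "matrix_inv (diag_powers p x) = diag_powers p (- x)"
proof (rule matrix_inv_eqI)
  show "diag_powers p x ** diag_powers p (- x) = mat 1"
    unfolding vec_eq_iff diag_powers_mult_left
    using assms by (simp add: diag_powers_def mat_def power_int_minus)
qed

text \<open>Conjugation by a diagonal matrix scales entry \<open>(c, b)\<close> by a power of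
  \<open>p\<close> with exponent \<open>x $ c - x $ b\<close>; this form avoids matrix inverses from
  here on.\<close>

lemma ZUT_mult:
  assumes "0 < p"
  shows "mult (ZUT p) g h = (fst g + fst h,
    \<chi> a b. \<Sum>c\<in>UNIV. snd g $ a $ c * real p powi (fst g $ c - fst g $ b) * snd h $ c $ b)"
  using assms
  by (simp add: ZUT_def case_prod_unfold matrix_inv_diag_powers vec_eq_iff matrix_matrix_mult_def[of "snd g"]
    diag_powers_mult_left diag_powers_mult_right power_int_diff power_int_minus field_simps)

lemma ZUT_one: "one (ZUT p) = (0, mat 1)"
  by (simp add: ZUT_def)

lemma ZUT_mult_one:
  assumes "0 < p"
  shows "mult (ZUT p) g (one (ZUT p)) = g" "mult (ZUT p) (one (ZUT p)) g = g"
  unfolding ZUT_mult[OF assms]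
  by (auto simp: ZUT_one prod_eq_iff vec_eq_iff mat_def if_distrib[of "\<lambda>z. _ * z"] if_distrib[of "\<lambda>z. z * _"] cong: if_cong)

lemma ZUT_mult_assoc:
  assumes "0 < p"
  shows "mult (ZUT p) (mult (ZUT p) g h) k = mult (ZUT p) g (mult (ZUT p) h k)"
proof -
  have "(\<Sum>c\<in>UNIV. (\<Sum>d\<in>UNIV. snd g $ a $ d * real p powi (fst g $ d - fst g $ c) * snd h $ d $ c)
        * real p powi (fst g $ c + fst h $ c - (fst g $ b + fst h $ b)) * snd k $ c $ b)
      = (\<Sum>d\<in>UNIV. snd g $ a $ d * real p powi (fst g $ d - fst g $ b)
        * (\<Sum>c\<in>UNIV. snd h $ d $ c * real p powi (fst h $ c - fst h $ b) * snd k $ c $ b))"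
    (is "?L = ?R") for a b
  proof -
    let ?t = "\<lambda>d c. snd g $ a $ d * snd h $ d $ c * snd k $ c $ b
      * (real p powi (fst g $ d - fst g $ b) * real p powi (fst h $ c - fst h $ b))"
    \<comment> \<open>The intermediate coordinate \<open>fst g $ c\<close> cancels in the
      exponents.\<close>
    have *: "real p powi (fst g $ d - fst g $ c) * real p powi (fst g $ c + fst h $ c - (fst g $ b + fst h $ b))
        = real p powi (fst g $ d - fst g $ b) * real p powi (fst h $ c - fst h $ b)" for c d
      using assms by (simp add: power_int_add[symmetric] algebra_simps)
    have "?L = (\<Sum>c\<in>UNIV. \<Sum>d\<in>UNIV. ?t d c)"
      unfolding sum_distrib_right by (intro sum.cong refl) (simp only: *[symmetric] mult_ac)
    also have "\<dots> = (\<Sum>d\<in>UNIV. \<Sum>c\<in>UNIV. ?t d c)"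
      by (rule sum.swap)
    also have "\<dots> = ?R"
      unfolding sum_distrib_left by (intro sum.cong refl) (simp only: mult_ac)
    finally show ?thesis .
  qed
  then show ?thesis
    unfolding ZUT_mult[OF assms] by (simp add: vec_eq_iff add.assoc)
qed

section \<open>Word length and the size of coordinates\<close>

lemma word_length_witness:
  assumes assoc: "\<And>x y z. mult G (mult G x y) z = mult G x (mult G y z)"
    and one: "\<And>x. mult G x (one G) = x" "\<And>x. mult G (one G) x = x"
    and h: "h \<in> generate G S"
  obtains ws where "length ws = word_length G S h" "set ws \<subseteq> S \<union> m_inv G ` S"
    "foldr (mult G) ws (one G) = h"
proof -
  have append: "foldr (mult G) (vs @ ws) (one G) = mult G (foldr (mult G) vs (one G)) (foldr (mult G) ws (one G))"
    for vs ws
    by (induction vs) (simp_all add: assoc one)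
  \<comment> \<open>Some word must exist for the \<open>LEAST\<close> in \<open>word_length\<close>
    to be attained; concatenation handles products.\<close>
  have "\<exists>ws. set ws \<subseteq> S \<union> m_inv G ` S \<and> foldr (mult G) ws (one G) = h"
    using h
  proof induction
    case one
    then show ?case by (intro exI[of _ "[]"]) simp
  next
    case (incl h)
    then show ?case by (intro exI[of _ "[h]"]) (simp add: one)
  next
    case (inv h)
    then show ?case by (intro exI[of _ "[m_inv G h]"]) (simp add: one)
  next
    case (eng h1 h2)
    then obtain vs ws where "set vs \<subseteq> S \<union> m_inv G ` S" "foldr (mult G) vs (one G) = h1"
      "set ws \<subseteq> S \<union> m_inv G ` S" "foldr (mult G) ws (one G) = h2"
      by blast
    then show ?case by (intro exI[of _ "vs @ ws"]) (simp add: append del: foldr_append)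
  qed
  then have "\<exists>m ws. length ws = m \<and> set ws \<subseteq> S \<union> m_inv G ` S \<and> foldr (mult G) ws (one G) = h"
    by blast
  from LeastI_ex[OF this] show thesis
    using that unfolding word_length_def by blast
qed

text \<open>Each letter shifts an integer coordinate by at most \<open>B\<close> and multiplies the
  bound on matrix entries by a constant \<open>K\<close>; the exponential rate is
  \<open>ln K\<close>.\<close>

lemma ZUT_word_length_bounds:
  fixes S :: "'n::{finite,linorder} elt set"
  assumes p: "0 < p" and S: "finite_generating_set (ZUT p) S"
  obtains B C :: real where
    "\<And>h a. h \<in> carrier (ZUT p) \<Longrightarrow> \<bar>real_of_int (fst h $ a)\<bar> \<le> B * word_length (ZUT p) S h"
    "\<And>h a b. h \<in> carrier (ZUT p) \<Longrightarrow> \<bar>snd h $ a $ b\<bar> \<le> exp (C * word_length (ZUT p) S h)"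
proof -
  let ?G = "ZUT p :: 'n elt monoid"
  define T where "T = S \<union> m_inv ?G ` S"
  \<comment> \<open>\<open>B\<close> bounds all coordinates of the finitely many letters; inserting
    1 ensures \<open>1 \<le> B\<close>.\<close>
  define B where "B = Max (insert 1 ((\<lambda>(t, a). \<bar>real_of_int (fst t $ a)\<bar>) ` (T \<times> UNIV)
    \<union> (\<lambda>(t, a, b). \<bar>snd t $ a $ b\<bar>) ` (T \<times> UNIV)))"
  have fin: "finite (insert 1 ((\<lambda>(t, a). \<bar>real_of_int (fst t $ a)\<bar>) ` (T \<times> UNIV)
    \<union> (\<lambda>(t, a, b). \<bar>snd t $ a $ b\<bar>) ` (T \<times> UNIV)))"
    using S by (simp add: T_def finite_generating_set_def)
  have B1: "1 \<le> B"
    unfolding B_def by (rule Max_ge[OF fin]) simp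
  have B_fst: "\<bar>real_of_int (fst t $ a)\<bar> \<le> B" if "t \<in> T" for t a
    unfolding B_def by (rule Max_ge[OF fin]) (use that in \<open>auto intro!: insertI2 UnI1 image_eqI[of _ _ "(t, a)"]\<close>)
  have B_snd: "\<bar>snd t $ a $ b\<bar> \<le> B" if "t \<in> T" for t a b
    unfolding B_def by (rule Max_ge[OF fin]) (use that in \<open>auto intro!: insertI2 UnI2 image_eqI[of _ _ "(t, a, b)"]\<close>)
  \<comment> \<open>For a letter the exponent of \<open>p\<close> is at most \<open>2 * B\<close>,
    so \<open>E\<close> bounds the power. In \<open>K\<close>, \<open>CARD('n)\<close> counts the
    summands of a matrix product entry.\<close>
  define E where "E = exp (2 * B * ln p)"
  define K where "K = CARD('n) * (B * E)"
  have lnp: "0 \<le> ln (real p)"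
    using p by simp
  have E1: "1 \<le> E"
    using B1 lnp by (simp add: E_def)
  have "1 * (1 * 1) \<le> K"
    unfolding K_def using B1 E1
    by (intro mult_mono) (simp_all add: Suc_le_eq)
  then have K1: "1 \<le> K" by simp
  \<comment> \<open>Letters are prepended, so the exponent of \<open>p\<close> involves only the new
    letter \<open>t\<close> and stays bounded however long the word is.\<close>
  have word: "(\<forall>a. \<bar>real_of_int (fst (foldr (mult ?G) ws (one ?G)) $ a)\<bar> \<le> B * length ws)
      \<and> (\<forall>a b. \<bar>snd (foldr (mult ?G) ws (one ?G)) $ a $ b\<bar> \<le> K ^ length ws)"
    if "set ws \<subseteq> T" for ws
    using that
  proof (induction ws)
    case Nil
    then show ?case by (simp add: ZUT_one mat_def)
  next
    case (Cons t ws)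
    then have t: "t \<in> T" by simp
    let ?h = "foldr (mult ?G) ws (one ?G)"
    have h: "\<bar>real_of_int (fst ?h $ a)\<bar> \<le> B * length ws" "\<bar>snd ?h $ a $ b\<bar> \<le> K ^ length ws" for a b
      using Cons by auto
    have "\<bar>real_of_int ((fst t + fst ?h) $ a)\<bar> \<le> B * length (t # ws)" for a
      using B_fst[OF t, of a] h(1)[of a] by (simp add: algebra_simps)
    moreover have "\<bar>\<Sum>c\<in>UNIV. snd t $ a $ c * real p powi (fst t $ c - fst t $ b) * snd ?h $ c $ b\<bar>
        \<le> K ^ length (t # ws)" for a b
    proof -
      have "\<bar>snd t $ a $ c * real p powi (fst t $ c - fst t $ b) * snd ?h $ c $ b\<bar>
          \<le> B * E * K ^ length ws" for c
      proof -
        have "real_of_int (fst t $ c - fst t $ b) \<le> 2 * B"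
          using B_fst[OF t, of c] B_fst[OF t, of b] by simp
        then have "real p powi (fst t $ c - fst t $ b) \<le> E"
          using p lnp unfolding E_def by (simp add: powi_eq_exp mult_right_mono)
        then have "\<bar>real p powi (fst t $ c - fst t $ b)\<bar> \<le> E"
          by simp
        then show ?thesis
          unfolding abs_mult using B_snd[OF t, of a c] h(2)[of c b] B1 E1 K1
          by (intro mult_mono) auto
      qed
      then have "\<bar>\<Sum>c\<in>UNIV. snd t $ a $ c * real p powi (fst t $ c - fst t $ b) * snd ?h $ c $ b\<bar>
          \<le> (\<Sum>c\<in>(UNIV :: 'n set). B * E * K ^ length ws)"
        by (intro order_trans[OF sum_abs] sum_mono)
      then show ?thesis
        by (simp add: K_def mult_ac)
    qed
    ultimately show ?case
      by (simp add: ZUT_mult[OF p, of t])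
  qed
  show thesis
  proof (rule that[of B "ln K"])
    fix h :: "'n elt" and a b :: 'n
    assume "h \<in> carrier (ZUT p)"
    then have "h \<in> generate (ZUT p) S"
      using S by (simp add: finite_generating_set_def)
    then obtain ws where ws: "length ws = word_length ?G S h" "set ws \<subseteq> S \<union> m_inv ?G ` S"
      "foldr (mult ?G) ws (one ?G) = h"
      by (rule word_length_witness[OF ZUT_mult_assoc[OF p] ZUT_mult_one[OF p]])
    show "\<bar>real_of_int (fst h $ a)\<bar> \<le> B * word_length (ZUT p) S h"
      using word[of ws] ws by (simp add: T_def)
    have "K ^ length ws = exp (ln K * length ws)"
      using K1 by (simp add: exp_of_nat2_mult)
    then show "\<bar>snd h $ a $ b\<bar> \<le> exp (ln K * word_length ?G S h)"
      using word[of ws] ws(2,3) unfolding ws(1)[symmetric] T_def by simp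
  qed
qed

section \<open>Coordinates of the random walk\<close>

lemma ZUT_walk_fst:
  assumes "0 < p"
  shows "fst (right_walk (ZUT p) h m) $ a = (\<Sum>k<m. fst (h (Suc k)) $ a)"
  by (induction m) (simp_all add: ZUT_one ZUT_mult[OF assms])

lemma ZUT_walk_snd_lower:
  fixes h :: "nat \<Rightarrow> 'n::{finite,linorder} elt"
  assumes p: "0 < p" and h: "\<And>m. h (Suc m) \<in> carrier (ZUT p)" and "k < i"
  shows "snd (right_walk (ZUT p) h m) $ i $ k = 0"
  using \<open>k < i\<close>
proof (induction m arbitrary: k)
  case 0
  then show ?case by (simp add: ZUT_one mat_def)
next
  case (Suc m)
  \<comment> \<open>One factor always vanishes: the walk entry if \<open>l < i\<close>, by
    induction, and otherwise the increment entry, which lies below the diagonal.\<close>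
  have "snd (right_walk (ZUT p) h m) $ i $ l * x * snd (h (Suc m)) $ l $ k = 0" for l x
  proof (cases "l < i")
    case False
    then have "snd (h (Suc m)) $ l $ k = 0"
      using h[of m] Suc.prems by (auto simp: ZUT_def UT_def)
    then show ?thesis by simp
  qed (simp add: Suc.IH)
  then have "(\<Sum>l\<in>UNIV. snd (right_walk (ZUT p) h m) $ i $ l
      * real p powi (fst (right_walk (ZUT p) h m) $ l - fst (right_walk (ZUT p) h m) $ k)
      * snd (h (Suc m)) $ l $ k) = 0"
    by (intro sum.neutral ballI)
  then show ?case by (simp add: ZUT_mult[OF p])
qed

text \<open>The diagonal entry 1 of the increment returns the old entry at \<open>l = k\<close>, and
  its zeros below the diagonal remove \<open>l > k\<close>.\<close>

lemma ZUT_walk_snd_Suc: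
  fixes h :: "nat \<Rightarrow> 'n::{finite,linorder} elt"
  assumes p: "0 < p" and h: "h (Suc m) \<in> carrier (ZUT p)"
  shows "snd (right_walk (ZUT p) h (Suc m)) $ i $ k = snd (right_walk (ZUT p) h m) $ i $ k
    + (\<Sum>l | l < k. snd (right_walk (ZUT p) h m) $ i $ l
        * (real p powi (fst (right_walk (ZUT p) h m) $ l - fst (right_walk (ZUT p) h m) $ k)
          * snd (h (Suc m)) $ l $ k))"
proof -
  let ?t = "\<lambda>l. snd (right_walk (ZUT p) h m) $ i $ l
        * (real p powi (fst (right_walk (ZUT p) h m) $ l - fst (right_walk (ZUT p) h m) $ k)
          * snd (h (Suc m)) $ l $ k)"
  have f: "snd (h (Suc m)) $ k $ k = 1" "\<And>l. k < l \<Longrightarrow> snd (h (Suc m)) $ l $ k = 0"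
    using h by (auto simp: ZUT_def UT_def)
  have "snd (right_walk (ZUT p) h (Suc m)) $ i $ k = (\<Sum>l\<in>UNIV. ?t l)"
    by (simp add: ZUT_mult[OF p] mult.assoc)
  also have "\<dots> = (\<Sum>l\<in>insert k {l. l < k}. ?t l)"
    by (rule sum.mono_neutral_right) (auto simp: f not_less order_less_le)
  also have "\<dots> = ?t k + (\<Sum>l | l < k. ?t l)"
    by (rule sum.insert) auto
  finally show ?thesis
    by (simp add: f)
qed

text \<open>A single term is a difference of consecutive partial sums, whose averages share a limit.
  For word lengths this makes exp (C |g_m|) subexponential.\<close>

lemma tendsto_increment_over_n:
  fixes x :: "nat \<Rightarrow> real"
  assumes "(\<lambda>n. (\<Sum>k<n. x k) / n) \<longlonglongrightarrow> L"
  shows "(\<lambda>n. x n / n) \<longlonglongrightarrow> 0"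
proof -
  let ?s = "\<lambda>n. \<Sum>k<n. x k"
  have "(\<lambda>n. ?s (Suc n) / real (Suc n) * (real (Suc n) / real n) - ?s n / n) \<longlonglongrightarrow> L * 1 - L"
    by (intro tendsto_diff tendsto_mult LIMSEQ_Suc[OF assms] assms LIMSEQ_Suc_n_over_n)
  then have "(\<lambda>n. ?s (Suc n) / real (Suc n) * (real (Suc n) / real n) - ?s n / n) \<longlonglongrightarrow> 0"
    by simp
  \<comment> \<open>At \<open>n = 0\<close> both sides are 0, since division by zero gives
    0.\<close>
  moreover have "?s (Suc n) / real (Suc n) * (real (Suc n) / real n) - ?s n / n = x n / n" for n
    by (simp add: diff_divide_distrib[symmetric] del: of_nat_Suc)
  ultimately show ?thesis by simp
qed

theorem proposition6p2p8:
  fixes p :: nat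
    and G :: "'n::{finite,linorder} elt monoid"
    and S :: "'n elt set"
    and \<mu> :: "'n elt pmf"
    and P :: "'w measure"
    and g :: "nat \<Rightarrow> 'w \<Rightarrow> 'n elt"
    and D :: "'n sq_matrix"
    and i j :: 'n
  assumes "prime p"
    and "G = ZUT p"
    and "set_pmf \<mu> \<subseteq> carrier G"
    and "finite_generating_set G S"
    and "integrable (measure_pmf \<mu>) (\<lambda>h. real (word_length G S h))"
    and "\<not> comm_group (subgroup_generated G (set_pmf \<mu>))"
    and "D = displacement_matrix \<mu>"
    and "i < j"
    and "D $ i $ j < 0"
    and "\<And>k. i < k \<Longrightarrow> k < j \<Longrightarrow> sgn (D $ i $ j) = sgn (D $ k $ j)"
    and "prob_space P"
    and "prob_space.indep_vars P (\<lambda>_. count_space UNIV) g {1..}"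
    and "\<And>k. k \<ge> 1 \<Longrightarrow> distr P (count_space UNIV) (g k) = measure_pmf \<mu>"
  shows "AE \<omega> in P. convergent (\<lambda>m. snd (right_walk G (\<lambda>k. g k \<omega>) m) $ i $ j)"
proof -
  interpret P: prob_space P by fact
  interpret \<mu>: sequence_space "measure_pmf \<mu>" ..
  have p: "1 < p" "0 < p"
    using prime_gt_1_nat[OF \<open>prime p\<close>] by auto
  then have ln_p: "0 < ln (real p)" by simp
  define L where "L h = real (word_length (ZUT p) S h)" for h :: "'n elt"
  have L: "integrable (measure_pmf \<mu>) L"
    using assms(2,5) unfolding L_def by simp
  have S: "finite_generating_set (ZUT p) S"
    using assms(2,4) by simp
  obtain B C :: real where
    B: "\<And>h a. h \<in> carrier (ZUT p) \<Longrightarrow> \<bar>real_of_int (fst h $ a)\<bar> \<le> B * L h" and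
    C: "\<And>h a b. h \<in> carrier (ZUT p) \<Longrightarrow> \<bar>snd h $ a $ b\<bar> \<le> exp (C * L h)"
    using ZUT_word_length_bounds[OF p(2) S] unfolding L_def by metis
  have carrier: "AE h in measure_pmf \<mu>. h \<in> carrier (ZUT p)"
    using assms(2,3) by (auto simp: AE_measure_pmf_iff)
  \<comment> \<open>\<open>c a\<close> is the almost sure exponential rate of \<open>p\<close>
    raised to coordinate \<open>a\<close> of the walk.\<close>
  define c where "c a = ln (real p) * first_moment (marginal \<mu> a)" for a
  have moment: "first_moment (marginal \<mu> a) = (\<integral>h. real_of_int (fst h $ a) \<partial>measure_pmf \<mu>)" for a
    by (simp add: first_moment_def marginal_def case_prod_unfold)
  \<comment> \<open>Integer coordinates are at most linear in word length, so the first moment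
    assumption gives them finite means.\<close>
  have fst_integrable: "integrable (measure_pmf \<mu>) (\<lambda>h. real_of_int (fst h $ a))" for a
  proof (rule Bochner_Integration.integrable_bound)
    show "integrable (measure_pmf \<mu>) (\<lambda>h. B * L h)"
      using L by simp
    show "AE h in measure_pmf \<mu>. norm (real_of_int (fst h $ a)) \<le> norm (B * L h)"
      using carrier by eventually_elim (metis B abs_ge_self order_trans real_norm_def)
  qed simp
  have D_neg: "D $ k $ j < 0" if "i \<le> k" "k < j" for k
  proof (cases "k = i")
    case False
    then have "sgn (D $ i $ j) = sgn (D $ k $ j)"
      using that by (intro assms(10)) auto
    then show ?thesis
      using assms(9) by (metis sgn_less)
  qed (use assms(9) in simp)
  have c_less: "c k < c j" if "i \<le> k" "k < j" for k
    using D_neg[OF that] ln_p assms(7) by (simp add: c_def displacement_matrix_def)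
  have "AE \<omega> in P. \<forall>a\<in>UNIV. (\<lambda>n. (\<Sum>k<n. real_of_int (fst (g (Suc k) \<omega>) $ a)) / n)
      \<longlonglongrightarrow> first_moment (marginal \<mu> a)"
  proof (rule AE_finite_allI)
    fix a
    show "AE \<omega> in P. (\<lambda>n. (\<Sum>k<n. real_of_int (fst (g (Suc k) \<omega>) $ a)) / n)
        \<longlonglongrightarrow> first_moment (marginal \<mu> a)"
      using P.AE_indep_vars_shift[OF assms(12,13) \<mu>.strong_law_of_large_numbers[OF fst_integrable[of a]]]
      by (simp add: moment)
  qed simp
  \<comment> \<open>Convergence of the averages of \<open>L\<close> is used only to make a single
    word length o(m).\<close>
  moreover have "AE \<omega> in P. (\<lambda>n. (\<Sum>k<n. L (g (Suc k) \<omega>)) / n) \<longlonglongrightarrow> (\<integral>h. L h \<partial>measure_pmf \<mu>)"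
    using P.AE_indep_vars_shift[OF assms(12,13) \<mu>.strong_law_of_large_numbers[OF L]] by simp
  moreover have "AE \<omega> in P. \<forall>k. g (Suc k) \<omega> \<in> carrier (ZUT p)"
    unfolding AE_all_countable
  proof
    fix k
    have "g (Suc k) \<in> P \<rightarrow>\<^sub>M count_space UNIV"
      using assms(12) by (simp add: P.indep_vars_def2)
    moreover have "AE h in distr P (count_space UNIV) (g (Suc k)). h \<in> carrier (ZUT p)"
      by (subst assms(13)) (use carrier in simp_all)
    ultimately show "AE \<omega> in P. g (Suc k) \<omega> \<in> carrier (ZUT p)"
      by (rule AE_distrD)
  qed
  ultimately show ?thesis
  proof eventually_elim
    case (elim \<omega>)
    define h where "h k = g k \<omega>" for k
    have h: "h (Suc k) \<in> carrier (ZUT p)" for k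
      using elim(3) by (simp add: h_def)
    define y where "y m = fst (right_walk (ZUT p) h m)" for m
    have y_lim: "(\<lambda>m. y m $ a / real m) \<longlonglongrightarrow> first_moment (marginal \<mu> a)" for a
      using elim(1) by (simp add: y_def ZUT_walk_fst[OF p(2)] h_def)
    have L_lim: "(\<lambda>m. L (h (Suc m)) / real m) \<longlonglongrightarrow> 0"
      using tendsto_increment_over_n[OF elim(2)] by (simp add: h_def)
    \<comment> \<open>The power of \<open>p\<close> has rate \<open>c l - c k\<close> by the law of
      large numbers; the increment entry contributes rate 0.\<close>
    have weight: "exp_growth (\<lambda>m. real p powi (y m $ l - y m $ k) * snd (h (Suc m)) $ l $ k) (c l - c k)"
      for l k
    proof (rule exp_growth_bound)
      have "(\<lambda>m. ln (real p) * (y m $ l / real m - y m $ k / real m)) \<longlonglongrightarrow> c l - c k"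
        unfolding c_def right_diff_distrib[symmetric] by (intro tendsto_intros y_lim)
      then have "exp_growth (\<lambda>m. exp ((y m $ l - y m $ k) * ln (real p))) (c l - c k)"
        by (intro exp_growth_exp) (simp add: diff_divide_distrib right_diff_distrib mult.commute)
      moreover have "exp_growth (\<lambda>m. exp (C * L (h (Suc m)))) 0"
        using tendsto_mult_left[OF L_lim, of C] by (intro exp_growth_exp) simp
      ultimately show "exp_growth (\<lambda>m. exp ((y m $ l - y m $ k) * ln (real p)) * exp (C * L (h (Suc m)))) (c l - c k)"
        using exp_growth_mult by fastforce
      show "\<bar>real p powi (y m $ l - y m $ k) * snd (h (Suc m)) $ l $ k\<bar>
          \<le> exp ((y m $ l - y m $ k) * ln (real p)) * exp (C * L (h (Suc m)))" for m
        using C[OF h[of m], of l k] p by (simp add: abs_mult powi_eq_exp)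
    qed
    have "convergent (\<lambda>m. snd (right_walk (ZUT p) h m) $ i $ j)"
    \<comment> \<open>Row \<open>i\<close> of the matrix part plays the role of \<open>a\<close>;
      \<open>c_less\<close> is the sign condition on \<open>D\<close> in terms of rates.\<close>
    proof (rule triangular_recursion_convergent[where i = i and c = c
          and w = "\<lambda>m l k. real p powi (y m $ l - y m $ k) * snd (h (Suc m)) $ l $ k"])
      fix m k
      show "snd (right_walk (ZUT p) h (Suc m)) $ i $ k = snd (right_walk (ZUT p) h m) $ i $ k
          + (\<Sum>l | l < k. snd (right_walk (ZUT p) h m) $ i $ l
              * (real p powi (y m $ l - y m $ k) * snd (h (Suc m)) $ l $ k))"
        unfolding y_def by (rule ZUT_walk_snd_Suc) (use p h in auto)
      show "snd (right_walk (ZUT p) h m) $ i $ k = 0" if "k < i"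
        by (rule ZUT_walk_snd_lower) (use p h that in auto)
    qed (use weight \<open>i < j\<close> c_less in auto)
    then show ?case
      unfolding h_def using assms(2) by simp
  qed
qed

end
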